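(* Let $V$ be a nonzero finite-dimensional $\square_q$-module. Then for every $i\in\mathbb{Z}_4$ the action of $x_i$ on $V$ is invertible.
   Context: Let $\mathbb{F}$ be an algebraically closed field and let $0\ne q\in\mathbb{F}$ be not a root of unity. Algebras are associative with $1$. $[3]_q=(q^3-q^{-3})/(q-q^{-1})$. Let $\mathbb{Z}_4=\mathbb{Z}/4\mathbb{Z}$; indices are taken in $\mathbb{Z}_4$. $\square_q$ is the $\mathbb{F}$-algebra with generators $\{x_i\}_{i\in\mathbb{Z}_4}$ and relations, for $i\in\mathbb{Z}_4$, $$\frac{qx_ix_{i+1}-q^{-1}x_{i+1}x_i}{q-q^{-1}}=1,\qquad x_i^3x_{i+2}-[3]_qx_i^2x_{i+2}x_i+[3]_qx_ix_{i+2}x_i^2-x_{i+2}x_i^3=0.$$ *)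

theory Defs
  imports
    "HOL-Computational_Algebra.Polynomial"
    "HOL-Library.Poly_Mapping"
    "HOL-Library.Numeral_Type"
    "HOL-Algebra.QuotRing"
    "HOL-Algebra.Module"
begin

section \<open>Associative unital algebras over a field\<close>

text \<open>
  The record type \<^typ>\<open>('f, 'a) module\<close> consists of a ring together with a scalar
  multiplication. The library locale \<^locale>\<open>algebra\<close> demands a commutative ring, so the
  noncommutative notion is introduced here, the scalars being the elements of a type of class
  \<^class>\<open>field\<close>.
\<close>

locale assoc_algebra = ring A for A :: "('f::field, 'a) module" (structure) +
  assumes smult_closed: "x \<in> carrier A \<Longrightarrow> c \<odot> x \<in> carrier A"
    and smult_l_distr: "x \<in> carrier A \<Longrightarrow> (c + d) \<odot> x = c \<odot> x \<oplus> d \<odot> x"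
    and smult_r_distr: "x \<in> carrier A \<Longrightarrow> y \<in> carrier A \<Longrightarrow> c \<odot> (x \<oplus> y) = c \<odot> x \<oplus> c \<odot> y"
    and smult_assoc: "x \<in> carrier A \<Longrightarrow> (c * d) \<odot> x = c \<odot> (d \<odot> x)"
    and smult_1: "x \<in> carrier A \<Longrightarrow> 1 \<odot> x = x"
    and smult_mult_left: "x \<in> carrier A \<Longrightarrow> y \<in> carrier A \<Longrightarrow> (c \<odot> x) \<otimes> y = c \<odot> (x \<otimes> y)"
    and smult_mult_right: "x \<in> carrier A \<Longrightarrow> y \<in> carrier A \<Longrightarrow> x \<otimes> (c \<odot> y) = c \<odot> (x \<otimes> y)"

definition quot_algebra :: "('f, 'a) module \<Rightarrow> 'a set \<Rightarrow> ('f, 'a set) module" where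
  "quot_algebra A I =
     ring.extend (A Quot I) (module.fields (\<lambda>c X. \<Union>x\<in>X. I +>\<^bsub>A\<^esub> (c \<odot>\<^bsub>A\<^esub> x)))"

lemma quot_algebra_simps:
  "carrier (quot_algebra A I) = carrier (A Quot I)"
  "monoid.mult (quot_algebra A I) = monoid.mult (A Quot I)"
  "monoid.one (quot_algebra A I) = monoid.one (A Quot I)"
  "ring.zero (quot_algebra A I) = ring.zero (A Quot I)"
  "ring.add (quot_algebra A I) = ring.add (A Quot I)"
  "module.smult (quot_algebra A I) = (\<lambda>c X. \<Union>x\<in>X. I +>\<^bsub>A\<^esub> (c \<odot>\<^bsub>A\<^esub> x))"
  by (simp_all add: quot_algebra_def ring.defs module.defs)

lemma ring_cong:
  assumes "ring R" "carrier S = carrier R" "monoid.mult S = monoid.mult R" "monoid.one S = monoid.one R"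
    "ring.zero S = ring.zero R" "ring.add S = ring.add R"
  shows "ring S"
proof -
  interpret ring R by fact
  show ?thesis
  proof (rule ringI)
    show "abelian_group S"
    proof (rule abelian_groupI)
      fix x assume "x \<in> carrier S"
      then show "\<exists>y\<in>carrier S. y \<oplus>\<^bsub>S\<^esub> x = \<zero>\<^bsub>S\<^esub>"
        using assms l_neg[of x] by auto
    qed (use assms in \<open>auto simp: a_ac\<close>)
    show "Group.monoid S"
      by (rule monoidI) (use assms in \<open>auto simp: m_assoc\<close>)
  qed (use assms in \<open>auto simp: l_distr r_distr\<close>)
qed

lemma (in assoc_algebra) smult_coset:
  assumes "ideal I A" "x \<in> carrier A"
  shows "(\<Union>y\<in>I +> x. I +> (c \<odot> y)) = I +> (c \<odot> x)"
proof -
  interpret I: ideal I A by fact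
  have "I +> (c \<odot> y) = I +> (c \<odot> x)" if y: "y \<in> I +> x" for y
  proof -
    obtain h where h: "h \<in> I" "y = h \<oplus> x"
      using y by (auto simp: a_r_coset_def')
    have hc: "h \<in> carrier A" using h I.a_Hcarr by blast
    have "c \<odot> h = (c \<odot> \<one>) \<otimes> h"
      using hc by (simp add: smult_mult_left)
    then have "c \<odot> h \<in> I"
      using h(1) I.I_l_closed smult_closed by auto
    then have "c \<odot> y \<in> I +> (c \<odot> x)"
      using h hc assms(2) by (auto simp: smult_r_distr a_r_coset_def')
    then show ?thesis
      using I.a_repr_independence' assms(2) smult_closed by blast
  qed
  moreover have "x \<in> I +> x"
    using assms(2) by (rule I.a_rcos_self)
  ultimately show ?thesis by blast
qed

lemma (in assoc_algebra) quot_algebra_assoc_algebra: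
  assumes "ideal I A"
  shows "assoc_algebra (quot_algebra A I)"
proof -
  interpret I: ideal I A by fact
  note defs = quot_algebra_simps FactRing_simps
  have sm: "c \<odot>\<^bsub>quot_algebra A I\<^esub> (I +> x) = I +> (c \<odot> x)" if "x \<in> carrier A" for c x
    using smult_coset[OF assms that] by (simp add: quot_algebra_simps)
  have ad: "(I +> x) \<oplus>\<^bsub>quot_algebra A I\<^esub> (I +> y) = I +> (x \<oplus> y)"
    if "x \<in> carrier A" "y \<in> carrier A" for x y
    using that by (simp add: defs I.a_rcos_sum)
  have mu: "(I +> x) \<otimes>\<^bsub>quot_algebra A I\<^esub> (I +> y) = I +> (x \<otimes> y)"
    if "x \<in> carrier A" "y \<in> carrier A" for x y
    using that by (simp add: defs I.rcoset_mult_add)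
  have ca: "carrier (quot_algebra A I) = (\<lambda>x. I +> x) ` carrier A"
    by (auto simp: defs)
  show ?thesis
  proof (intro assoc_algebra.intro assoc_algebra_axioms.intro)
    show "ring (quot_algebra A I)"
      by (rule ring_cong[OF I.quotient_is_ring]) (simp_all add: quot_algebra_simps)
  qed (auto simp: ca sm ad mu smult_closed smult_l_distr smult_r_distr smult_assoc smult_1
      smult_mult_left smult_mult_right)
qed


section \<open>Modules over an algebra\<close>

text \<open>
  The vector space underlying the module is the whole type \<^typ>\<open>'v\<close>, with scalar
  multiplication \<open>scale\<close>; an element \<open>a\<close> of the algebra acts on it as \<open>act a\<close>.
  The values of \<open>act\<close> outside the carrier of the algebra are irrelevant.
\<close>

locale algebra_module =
  assoc_algebra A + vector_space scale
  for A :: "('f::field, 'a) module" (structure)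
    and scale :: "'f \<Rightarrow> 'v::ab_group_add \<Rightarrow> 'v" +
  fixes act :: "'a \<Rightarrow> 'v \<Rightarrow> 'v"
  assumes act_linear: "a \<in> carrier A \<Longrightarrow> Vector_Spaces.linear scale scale (act a)"
    and act_add: "a \<in> carrier A \<Longrightarrow> b \<in> carrier A \<Longrightarrow> act (a \<oplus> b) v = act a v + act b v"
    and act_smult: "a \<in> carrier A \<Longrightarrow> act (c \<odot> a) v = scale c (act a v)"
    and act_mult: "a \<in> carrier A \<Longrightarrow> b \<in> carrier A \<Longrightarrow> act (a \<otimes> b) v = act a (act b v)"
    and act_one: "act \<one> v = v"

definition finite_dim :: "('f::field \<Rightarrow> 'v::ab_group_add \<Rightarrow> 'v) \<Rightarrow> bool" where
  "finite_dim scale \<longleftrightarrow> (\<exists>B. finite B \<and> module.span scale B = UNIV)"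

definition invertible_linear :: "('f::field \<Rightarrow> 'v::ab_group_add \<Rightarrow> 'v) \<Rightarrow> ('v \<Rightarrow> 'v) \<Rightarrow> bool" where
  "invertible_linear scale f \<longleftrightarrow> Vector_Spaces.linear scale scale f \<and>
     (\<exists>g. Vector_Spaces.linear scale scale g \<and> g \<circ> f = id \<and> f \<circ> g = id)"


section \<open>Free algebras\<close>

text \<open>
  The words over an alphabet form a monoid under concatenation, written additively so that the
  convolution product of finitely supported functions on words is the product of the
  free algebra.
\<close>

datatype 'i word = Word "'i list"

instantiation word :: (type) monoid_add
begin

definition zero_word :: "'i word" where
  "zero_word = Word []"

fun plus_word :: "'i word \<Rightarrow> 'i word \<Rightarrow> 'i word" where
  "plus_word (Word u) (Word v) = Word (u @ v)"

instance
proof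
  fix a b c :: "'i word"
  show "a + b + c = a + (b + c)" by (cases a; cases b; cases c) simp
  show "0 + a = a" by (cases a) (simp add: zero_word_def)
  show "a + 0 = a" by (cases a) (simp add: zero_word_def)
qed

end

definition scalar :: "'f \<Rightarrow> ('i word \<Rightarrow>\<^sub>0 'f::field)" where
  "scalar c = Poly_Mapping.single 0 c"

definition var :: "'i \<Rightarrow> ('i word \<Rightarrow>\<^sub>0 'f::field)" where
  "var i = Poly_Mapping.single (Word [i]) 1"

definition free_algebra :: "('f::field, 'i word \<Rightarrow>\<^sub>0 'f) module" where
  "free_algebra = \<lparr>carrier = UNIV, mult = (*), one = 1, zero = 0, add = (+),
     smult = (\<lambda>c p. scalar c * p)\<rparr>"

lemma scalar_commute: "scalar c * p = p * (scalar c :: 'i word \<Rightarrow>\<^sub>0 'f::field)"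
proof (induction p rule: update_induct)
  case const
  show ?case by simp
next
  case (update f a b)
  have "Poly_Mapping.update a b f = f + Poly_Mapping.single a b"
    using update(1)
    by (intro poly_mapping_eqI)
      (auto simp: lookup_update lookup_add lookup_single in_keys_iff when_def)
  moreover have "scalar c * Poly_Mapping.single a b = Poly_Mapping.single a b * scalar c"
    by (simp add: scalar_def mult_single mult.commute)
  ultimately show ?case
    using update(3) by (simp add: distrib_left distrib_right)
qed

lemma free_algebra_assoc_algebra:
  "assoc_algebra (free_algebra :: ('f::field, 'i word \<Rightarrow>\<^sub>0 'f) module)"
proof (intro assoc_algebra.intro assoc_algebra_axioms.intro)
  show "ring (free_algebra :: ('f, 'i word \<Rightarrow>\<^sub>0 'f) module)"
  proof (rule ringI)
    show "abelian_group (free_algebra :: ('f, 'i word \<Rightarrow>\<^sub>0 'f) module)"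
      by (rule abelian_groupI)
        (auto simp: free_algebra_def algebra_simps intro: exI[of _ "- _"] left_minus)
    show "Group.monoid (free_algebra :: ('f, 'i word \<Rightarrow>\<^sub>0 'f) module)"
      by (rule monoidI) (auto simp: free_algebra_def algebra_simps)
  qed (auto simp: free_algebra_def algebra_simps)
next
  fix x y :: "'i word \<Rightarrow>\<^sub>0 'f" and c
  show "x \<otimes>\<^bsub>free_algebra\<^esub> (c \<odot>\<^bsub>free_algebra\<^esub> y) = c \<odot>\<^bsub>free_algebra\<^esub> (x \<otimes>\<^bsub>free_algebra\<^esub> y)"
    by (simp add: free_algebra_def) (metis mult.assoc scalar_commute)
qed (auto simp: free_algebra_def scalar_def algebra_simps single_add
      mult_single[of 0 _ 0, simplified, symmetric])


section \<open>The algebra \<open>\<box>\<^sub>q\<close>\<close>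

definition qint :: "'f::field \<Rightarrow> nat \<Rightarrow> 'f" where
  "qint q n = (q ^ n - inverse q ^ n) / (q - inverse q)"

text \<open>
  The generators are indexed by the type \<^typ>\<open>4\<close>, whose arithmetic is that of the integers
  modulo 4. Every relation is represented by the difference of its two sides.
\<close>

definition weyl_relator :: "'f::field \<Rightarrow> 4 \<Rightarrow> (4 word \<Rightarrow>\<^sub>0 'f)" where
  "weyl_relator q i =
     scalar (1 / (q - inverse q)) *
       (scalar q * var i * var (i + 1) - scalar (inverse q) * var (i + 1) * var i) - 1"

definition serre_relator :: "'f::field \<Rightarrow> 4 \<Rightarrow> (4 word \<Rightarrow>\<^sub>0 'f)" where
  "serre_relator q i =
     var i ^ 3 * var (i + 2)
     - scalar (qint q 3) * var i ^ 2 * var (i + 2) * var i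
     + scalar (qint q 3) * var i * var (i + 2) * var i ^ 2
     - var (i + 2) * var i ^ 3"

definition box_ideal :: "'f::field \<Rightarrow> (4 word \<Rightarrow>\<^sub>0 'f) set" where
  "box_ideal q =
     genideal (free_algebra :: ('f, 4 word \<Rightarrow>\<^sub>0 'f) module)
       (range (weyl_relator q) \<union> range (serre_relator q))"

definition box :: "'f::field \<Rightarrow> ('f, (4 word \<Rightarrow>\<^sub>0 'f) set) module" where
  "box q = quot_algebra free_algebra (box_ideal q)"

definition box_gen :: "'f::field \<Rightarrow> 4 \<Rightarrow> (4 word \<Rightarrow>\<^sub>0 'f) set" where
  "box_gen q i = box_ideal q +>\<^bsub>(free_algebra :: ('f, 4 word \<Rightarrow>\<^sub>0 'f) module)\<^esub> var i"

lemma box_ideal_ideal: "ideal (box_ideal q) (free_algebra :: ('f::field, 4 word \<Rightarrow>\<^sub>0 'f) module)"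
proof -
  interpret assoc_algebra "free_algebra :: ('f, 4 word \<Rightarrow>\<^sub>0 'f) module"
    by (rule free_algebra_assoc_algebra)
  show ?thesis
    unfolding box_ideal_def by (rule genideal_ideal) (simp add: free_algebra_def)
qed

lemma box_assoc_algebra: "assoc_algebra (box q)"
  unfolding box_def
  by (rule assoc_algebra.quot_algebra_assoc_algebra[OF free_algebra_assoc_algebra box_ideal_ideal])

lemma box_gen_carrier: "box_gen (q :: 'f::field) i \<in> carrier (box q)"
proof -
  interpret ideal "box_ideal q" "free_algebra :: ('f, 4 word \<Rightarrow>\<^sub>0 'f) module"
    by (rule box_ideal_ideal)
  have "var i \<in> carrier (free_algebra :: ('f, 4 word \<Rightarrow>\<^sub>0 'f) module)"
    by (simp add: free_algebra_def)
  then show ?thesis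
    using a_rcosetsI[OF a_subset]
    by (simp add: box_def box_gen_def quot_algebra_simps FactRing_def)
qed

end

theory Submission
  imports Defs
begin

text \<open>
  Write \<open>x\<close> and \<open>y\<close> for the actions of the generators \<open>x\<^sub>i\<close> and \<open>x\<^sub>i\<^sub>+\<^sub>1\<close>, and put \<open>r = q\<^sup>-\<^sup>2\<close>. The
  first defining relation says that \<open>x y = r y x + (1 - r)\<close>. If \<open>x v = 0\<close> for some \<open>v \<noteq> 0\<close>, then
  this relation makes \<open>v, y v, y\<^sup>2 v, \<dots>\<close> behave like the states above a vacuum: \<open>x\<close> lowers
  \<open>y\<^sup>n v\<close> to \<open>(1 - r\<^sup>n) y\<^sup>n\<^sup>-\<^sup>1 v\<close>, and these factors do not vanish because \<open>q\<close> is not a root of unity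
  (\<open>q_weyl_lowering\<close>). Hence \<open>y\<^sup>n v\<close> lies in the kernel of \<open>x\<^sup>n\<^sup>+\<^sup>1\<close> but not in that of \<open>x\<^sup>n\<close>, so the kernels
  of the powers of \<open>x\<close> increase forever, which a finite-dimensional space does not permit
  (\<open>lowering_operator_vacuum_eq_0\<close>). So \<open>x\<close> is injective, and therefore bijective.
\<close>

context vector_space
begin

lemma finite_spanning_set_contains_basis:
  assumes "finite B" "span B = UNIV"
  obtains C where "finite_dimensional_vector_space scale C"
proof -
  obtain C where C: "C \<subseteq> B" "independent C" "B \<subseteq> span C"
    using maximal_independent_subset by blast
  have "span B \<subseteq> span C"
    using C(3) by (rule span_minimal) (rule subspace_span)
  then have "finite_dimensional_vector_space scale C"
    using C(1,2) assms finite_subset by unfold_locales auto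
  then show thesis by (rule that)
qed

lemma not_in_earlier_span_imp_independent:
  assumes "\<And>n. u n \<notin> span (u ` {..<n::nat})"
  shows "independent (u ` {..<n}) \<and> card (u ` {..<n}) = n"
proof (induction n)
  case 0
  show ?case by (simp add: independent_empty)
next
  case (Suc n)
  have "u n \<notin> u ` {..<n}"
    using assms[of n] span_base[of "u n" "u ` {..<n}"] by (rule contrapos_nn)
  then show ?case
    using Suc assms[of n]
    by (simp only: lessThan_Suc image_insert independent_insert card_insert_disjoint
        finite_imageI finite_lessThan if_False simp_thms)
qed

text \<open>
  The vector \<open>u n\<close> escapes the span of its predecessors because \<open>x\<^sup>n\<close> kills all of them, while it
  takes \<open>u n\<close> to a nonzero multiple of \<open>u 0\<close>. So \<open>u 0 \<noteq> 0\<close> would produce arbitrarily large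
  independent sets.
\<close>

lemma lowering_operator_vacuum_eq_0:
  assumes fin: "finite B" "span B = UNIV"
    and lin: "Vector_Spaces.linear scale scale x"
    and vacuum: "x (u 0) = 0"
    and step: "\<And>n. x (u (Suc n)) = scale (c n) (u n)"
    and nonzero: "\<And>n. c n \<noteq> 0"
  shows "u 0 = 0"
proof (rule ccontr)
  assume u0: "u 0 \<noteq> 0"
  interpret x: Vector_Spaces.linear scale scale x by (rule lin)
  have pow_scale: "(x ^^ n) (scale a w) = scale a ((x ^^ n) w)" for n a w
    by (induction n) (simp_all add: x.scale)
  have pow_add: "(x ^^ n) (w + w') = (x ^^ n) w + (x ^^ n) w'" for n w w'
    by (induction n) (simp_all add: x.add)
  have pow_0: "(x ^^ n) 0 = 0" for n
    by (induction n) (simp_all add: x.zero)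
  have top: "(x ^^ n) (u n) \<noteq> 0" for n
    by (induction n) (simp_all add: u0 step nonzero pow_scale funpow_Suc_right del: funpow.simps)
  have killed: "(x ^^ n) (u k) = 0" if "k < n" for n k
    using that
  proof (induction k arbitrary: n)
    case 0
    then show ?case
      by (cases n) (simp_all add: vacuum pow_0 funpow_Suc_right del: funpow.simps)
  next
    case (Suc k)
    then show ?case
      by (cases n) (simp_all add: step pow_scale funpow_Suc_right del: funpow.simps)
  qed
  have "u n \<notin> span (u ` {..<n})" for n
  proof
    assume "u n \<in> span (u ` {..<n})"
    moreover have "subspace {w. (x ^^ n) w = 0}"
      by (simp add: subspace_def pow_0 pow_add pow_scale)
    moreover have "u ` {..<n} \<subseteq> {w. (x ^^ n) w = 0}"
      using killed by auto
    ultimately have "u n \<in> {w. (x ^^ n) w = 0}"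
      using span_minimal[of "u ` {..<n}" "{w. (x ^^ n) w = 0}"] by (meson subsetD)
    then show False using top by simp
  qed
  then have ind: "independent (u ` {..<n})" "card (u ` {..<n}) = n" for n
    using not_in_earlier_span_imp_independent by blast+
  have "Suc (card B) \<le> card B"
    using independent_span_bound[OF fin(1) ind(1)[of "Suc (card B)"]] ind(2)[of "Suc (card B)"]
      fin(2) by auto
  then show False by simp
qed

text \<open>
  Moving \<open>x\<close> past one factor \<open>y\<close> multiplies by \<open>r\<close> and adds \<open>1 - r\<close>; the constants \<open>1 - r\<^sup>n\<close> solve the
  recursion \<open>c\<^sub>n\<^sub>+\<^sub>1 = r c\<^sub>n + (1 - r)\<close>, \<open>c\<^sub>0 = 0\<close>.
\<close>

lemma q_weyl_lowering:
  assumes lin: "Vector_Spaces.linear scale scale y"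
    and weyl: "\<And>w. x (y w) = scale r (y (x w)) + scale (1 - r) w"
    and vacuum: "x v = 0"
  shows "x ((y ^^ Suc n) v) = scale (1 - r ^ Suc n) ((y ^^ n) v)"
proof -
  interpret y: Vector_Spaces.linear scale scale y by (rule lin)
  show ?thesis
  proof (induction n)
    case 0
    show ?case by (simp add: weyl vacuum y.zero)
  next
    case (Suc n)
    have "x ((y ^^ Suc (Suc n)) v)
        = scale r (y (x ((y ^^ Suc n) v))) + scale (1 - r) ((y ^^ Suc n) v)"
      using weyl[of "(y ^^ Suc n) v"] by simp
    also have "y (x ((y ^^ Suc n) v)) = scale (1 - r ^ Suc n) ((y ^^ Suc n) v)"
      unfolding Suc y.scale by simp
    also have "scale r (scale (1 - r ^ Suc n) ((y ^^ Suc n) v)) + scale (1 - r) ((y ^^ Suc n) v)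
        = scale (r * (1 - r ^ Suc n) + (1 - r)) ((y ^^ Suc n) v)"
      by (simp only: scale_scale scale_left_distrib)
    also have "r * (1 - r ^ Suc n) + (1 - r) = 1 - r ^ Suc (Suc n)"
      by (simp add: algebra_simps)
    finally show ?case .
  qed
qed

lemma q_weyl_invertible:
  assumes "finite_dim scale"
    and x: "Vector_Spaces.linear scale scale x"
    and y: "Vector_Spaces.linear scale scale y"
    and weyl: "\<And>w. x (y w) = scale r (y (x w)) + scale (1 - r) w"
    and r: "\<And>n. n > 0 \<Longrightarrow> r ^ n \<noteq> 1"
  shows "invertible_linear scale x"
proof -
  interpret x: Vector_Spaces.linear scale scale x by (rule x)
  obtain B where B: "finite B" "span B = UNIV"
    using assms(1) by (auto simp: finite_dim_def)
  have "v = 0" if v: "x v = 0" for v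
  proof -
    have "(y ^^ 0) v = 0"
    proof (rule lowering_operator_vacuum_eq_0[OF B x])
      show "x ((y ^^ 0) v) = 0" using v by simp
      show "x ((y ^^ Suc n) v) = scale (1 - r ^ Suc n) ((y ^^ n) v)" for n
        by (rule q_weyl_lowering[OF y weyl v])
      show "1 - r ^ Suc n \<noteq> 0" for n
        using r[of "Suc n"] by simp
    qed
    then show ?thesis by simp
  qed
  then have inj: "inj x"
    by (simp add: x.inj_iff_eq_0)
  obtain C where "finite_dimensional_vector_space scale C"
    using finite_spanning_set_contains_basis[OF B] .
  then interpret finite_dimensional_vector_space scale C .
  have "surj x"
    using linear_inj_imp_surj[OF x inj] .
  then show ?thesis
    unfolding invertible_linear_def
    using x inj_linear_imp_inv_linear[OF x inj] inj_iff[THEN iffD1, OF inj]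
      surj_iff[THEN iffD1, OF \<open>surj x\<close>] by blast
qed

end

text \<open>
  A module over the quotient is a module over the free algebra on which every element of the ideal
  acts as zero. Expanding the action of \<^const>\<open>weyl_relator\<close>, an element of the ideal, turns the
  relation of the algebra into one between operators.
\<close>

lemma box_gen_weyl:
  fixes q :: "'f::field"
  assumes "algebra_module (box q) scale act"
  shows "scale (1 / (q - inverse q))
      (scale q (act (box_gen q i) (act (box_gen q (i + 1)) v))
        - scale (inverse q) (act (box_gen q (i + 1)) (act (box_gen q i) v))) = v"
proof -
  \<comment> \<open>\<open>rho\<close> is the representation of the free algebra obtained by pulling back \<open>act\<close> along the
    projection \<open>pr\<close> onto the quotient.\<close>
  let ?A = "free_algebra :: ('f, 4 word \<Rightarrow>\<^sub>0 'f) module"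
  let ?I = "box_ideal q"
  interpret algebra_module "box q" scale act by fact
  interpret A: assoc_algebra ?A by (rule free_algebra_assoc_algebra)
  interpret I: ideal ?I ?A by (rule box_ideal_ideal)
  have A: "p \<in> carrier ?A" for p
    by (simp add: free_algebra_def)
  define pr where "pr p = ?I +>\<^bsub>?A\<^esub> p" for p
  define rho where "rho p = act (pr p)" for p
  have carr: "pr p \<in> carrier (box q)" for p
    by (auto simp: pr_def box_def quot_algebra_simps FactRing_simps A)
  have pr_add: "pr (p + p') = pr p \<oplus>\<^bsub>box q\<^esub> pr p'" for p p'
    using I.a_rcos_sum[OF A A, of p p']
    by (simp add: pr_def box_def quot_algebra_simps FactRing_simps) (simp add: free_algebra_def)
  have pr_mult: "pr (p * p') = pr p \<otimes>\<^bsub>box q\<^esub> pr p'" for p p'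
    using I.rcoset_mult_add[OF A A, of p p']
    by (simp add: pr_def box_def quot_algebra_simps FactRing_simps) (simp add: free_algebra_def)
  have pr_smult: "pr (scalar c * p) = c \<odot>\<^bsub>box q\<^esub> pr p" for c p
    using A.smult_coset[OF box_ideal_ideal A, where c = c and x = p]
    by (simp add: pr_def box_def quot_algebra_simps) (simp add: free_algebra_def)
  have pr_one: "pr 1 = \<one>\<^bsub>box q\<^esub>"
    by (simp add: pr_def box_def quot_algebra_simps FactRing_simps) (simp add: free_algebra_def)
  have rho_add: "rho (p + p') w = rho p w + rho p' w" for p p' w
    by (simp add: rho_def pr_add act_add carr)
  have rho_diff: "rho (p - p') w = rho p w - rho p' w" for p p' w
    using rho_add[of "p - p'" p' w] by simp
  have rho_mult: "rho (p * p') w = rho p (rho p' w)" for p p' w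
    by (simp add: rho_def pr_mult act_mult carr)
  have rho_one: "rho 1 w = w" for w
    by (simp add: rho_def pr_one act_one)
  have "rho (scalar c * 1) w = scale c (rho 1 w)" for c w
    by (simp only: rho_def pr_smult act_smult carr)
  then have rho_scalar: "rho (scalar c) w = scale c w" for c w
    by (simp add: rho_one)
  have "range (weyl_relator q) \<union> range (serre_relator q) \<subseteq> ?I"
    unfolding box_ideal_def by (rule A.genideal_self) (simp add: free_algebra_def)
  then have mem: "weyl_relator q i \<in> ?I" by blast
  have "pr (weyl_relator q i) = pr 0"
    using I.a_rcos_const[OF mem] I.a_rcos_const[OF I.zero_closed]
    by (simp add: pr_def free_algebra_def)
  moreover have "rho 0 v = 0"
    using rho_add[of 0 0 v] by simp
  ultimately have "rho (weyl_relator q i) v = 0"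
    by (simp add: rho_def)
  moreover have "act (box_gen q j) = rho (var j)" for j
    by (simp add: rho_def pr_def box_gen_def)
  ultimately show ?thesis
    by (simp add: weyl_relator_def rho_diff rho_scalar rho_mult rho_one)
qed

theorem proposition5p2:
  fixes q :: "'f::alg_closed_field"
    and scale :: "'f \<Rightarrow> 'v::ab_group_add \<Rightarrow> 'v"
    and act :: "(4 word \<Rightarrow>\<^sub>0 'f) set \<Rightarrow> 'v \<Rightarrow> 'v"
  assumes "q \<noteq> 0"
    and "\<forall>n>0. q ^ n \<noteq> 1"
    and "algebra_module (box q) scale act"
    and "finite_dim scale"
    and "\<exists>v::'v. v \<noteq> 0"
  shows "\<forall>i::4. invertible_linear scale (act (box_gen q i))"
proof
  fix i :: 4
  interpret algebra_module "box q" scale act by fact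
  let ?x = "act (box_gen q i)" and ?y = "act (box_gen q (i + 1))"
  define r where "r = inverse (q ^ 2)"
  have q2: "q ^ 2 \<noteq> 1"
    using assms(2) by simp
  then have d: "q - inverse q \<noteq> 0"
    using assms(1) by (auto simp: field_simps power2_eq_square)
  have weyl: "?x (?y w) = scale r (?y (?x w)) + scale (1 - r) w" for w
  proof -
    have "scale (q - inverse q) w = scale q (?x (?y w)) - scale (inverse q) (?y (?x w))"
      using arg_cong[OF box_gen_weyl[OF assms(3), of i w], of "scale (q - inverse q)"] d by simp
    then have "scale q (?x (?y w)) = scale (inverse q) (?y (?x w)) + scale (q - inverse q) w"
      by simp
    from arg_cong[OF this, of "scale (inverse q)"] show ?thesis
      using assms(1) by (simp add: scale_right_distrib r_def power2_eq_square right_diff_distrib)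
  qed
  have "r ^ n \<noteq> 1" if "n > 0" for n
  proof -
    have "q ^ (2 * n) \<noteq> 1" using assms(2) that by simp
    then show ?thesis by (simp add: r_def power_inverse power_mult)
  qed
  then show "invertible_linear scale ?x"
    using q_weyl_invertible[OF assms(4) act_linear[OF box_gen_carrier]
        act_linear[OF box_gen_carrier] weyl] by blast
qed

end
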